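(* Let $E$ be a countable set, let $A=(a_{ij})_{i,j\in E}$ be a real matrix, and fix $k\in E$. Assume: (1) $A$ is non-negative and irreducible on $E$; (2) $f(i):=\sum_{j\in E}a_{ij}<\infty$ for every $i\in E$; (3) $A$ is $R$-recurrent, where $R$ is the convergence parameter of $A$, and $R>0$. Let $X=(X_n)_{n\ge 0}$ be the Markov chain on $E$ with transition probabilities $m_{ij}=a_{ij}/f(i)$, $i,j\in E$, let $\tau_k^+=\inf\{n\ge 1: X_n=k\}$, and let $\mathbb{E}_k$ denote expectation for the chain started at $X_0=k$. Then $$u_i:=\mathbb{E}_k\left(\sum_{n=0}^{\tau_k^+-1}\left(I_{[X_n=i]}\,R^{n}\prod_{m=0}^{n-1}f(X_m)\right)\right)\in(0,\infty)\qquad\text{for all } i\in E,$$ and the row vector $u=(u_i)_{i\in E}$ satisfies $uA=(1/R)\,u$, i.e. $\sum_{i\in E}u_i a_{ij}=(1/R)u_j$ for all $j\in E$.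
   Context: Write $A^n=(a_{ij}^{(n)})_{i,j\in E}$ for the powers of $A$, with $A^0=I$; entries may a priori take values in $[0,\infty]$. A non-negative matrix $A$ is irreducible if for all $i,j\in E$ there is $n\ge 1$ with $a_{ij}^{(n)}>0$ (in particular $f(i)>0$ for all $i$). The convergence parameter of a non-negative irreducible matrix $A$ is $$R=\inf\Big\{r\ge 0:\sum_{n=0}^\infty r^n a_{ij}^{(n)}=\infty\Big\}=\sup\Big\{r\ge 0:\sum_{n=0}^\infty r^n a_{ij}^{(n)}<\infty\Big\},$$ which does not depend on $i,j\in E$. $A$ is called $R$-recurrent if $\sum_{n=0}^\infty R^n a_{ij}^{(n)}=\infty$ (for $i,j\in E$) with $R$ its convergence parameter. Conventions: $\inf\emptyset=\infty$ (so $\tau_k^+$ may be infinite, in which case the sum in $u_i$ runs over all $n\ge0$), and empty products equal $1$. $I_{[\cdot]}$ is the indicator of an event. *)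

theory Defs
  imports "HOL-Probability.Probability"
begin

text \<open>
  The countable index set $E$ is the universe of a type of class \<open>countable\<close>. Quantities that may
  a priori be infinite live in \<^typ>\<open>ennreal\<close>. The coercion \<^const>\<open>ennreal\<close> truncates negative reals
  to \<open>0\<close>, so the definitions below have their intended meaning for non-negative \<open>A\<close> only.
\<close>

definition nonneg_matrix :: "('a \<Rightarrow> 'a \<Rightarrow> real) \<Rightarrow> bool" where
  "nonneg_matrix A \<longleftrightarrow> (\<forall>i j. 0 \<le> A i j)"

primrec mat_pow :: "('a \<Rightarrow> 'a \<Rightarrow> real) \<Rightarrow> nat \<Rightarrow> 'a \<Rightarrow> 'a \<Rightarrow> ennreal" where
  "mat_pow A 0 = (\<lambda>i j. if i = j then 1 else 0)"
| "mat_pow A (Suc n) = (\<lambda>i j. \<Sum>\<^sub>\<infinity>l. mat_pow A n i l * ennreal (A l j))"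

definition irreducible_matrix :: "('a \<Rightarrow> 'a \<Rightarrow> real) \<Rightarrow> bool" where
  "irreducible_matrix A \<longleftrightarrow> (\<forall>i j. \<exists>n\<ge>1. 0 < mat_pow A n i j)"

definition row_sum :: "('a \<Rightarrow> 'a \<Rightarrow> real) \<Rightarrow> 'a \<Rightarrow> ennreal" where
  "row_sum A i = (\<Sum>\<^sub>\<infinity>j. ennreal (A i j))"

definition green :: "('a \<Rightarrow> 'a \<Rightarrow> real) \<Rightarrow> ennreal \<Rightarrow> 'a \<Rightarrow> 'a \<Rightarrow> ennreal" where
  "green A r i j = (\<Sum>n. r ^ n * mat_pow A n i j)"

text \<open>
  For a non-negative irreducible matrix the following value does not depend on \<open>i\<close> and \<open>j\<close>, and the
  infimum may be replaced by a supremum; see the lemmas \<open>convergence_parameter_indep\<close> and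
  \<open>convergence_parameter_eq_Sup\<close> below.
\<close>

definition convergence_parameter :: "('a \<Rightarrow> 'a \<Rightarrow> real) \<Rightarrow> 'a \<Rightarrow> 'a \<Rightarrow> ennreal" where
  "convergence_parameter A i j = Inf {r. r < \<infinity> \<and> green A r i j = \<infinity>}"

definition R_recurrent :: "('a \<Rightarrow> 'a \<Rightarrow> real) \<Rightarrow> ennreal \<Rightarrow> bool" where
  "R_recurrent A R \<longleftrightarrow> (\<forall>i j. convergence_parameter A i j = R \<and> green A R i j = \<infinity>)"

definition transition_prob :: "('a \<Rightarrow> 'a \<Rightarrow> real) \<Rightarrow> 'a \<Rightarrow> 'a \<Rightarrow> real" where
  "transition_prob A i j = A i j / enn2real (row_sum A i)"

text \<open>
  \<open>markov_chain_from M X P k\<close>: on the probability space \<open>M\<close>, the process \<open>X\<close> is a Markov chain with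
  transition probabilities \<open>P\<close> started at \<open>k\<close>. The conditional probability is only constrained when the
  conditioning event has positive probability.
\<close>

definition markov_chain_from ::
  "'w measure \<Rightarrow> (nat \<Rightarrow> 'w \<Rightarrow> 'a) \<Rightarrow> ('a \<Rightarrow> 'a \<Rightarrow> real) \<Rightarrow> 'a \<Rightarrow> bool" where
  "markov_chain_from M X P k \<longleftrightarrow>
     prob_space M \<and>
     (\<forall>n. X n \<in> measurable M (count_space UNIV)) \<and>
     (AE \<omega> in M. X 0 \<omega> = k) \<and>
     (\<forall>n x j. \<P>(\<omega> in M. \<forall>m\<le>n. X m \<omega> = x m) > 0 \<longrightarrow>
        \<P>(\<omega> in M. X (Suc n) \<omega> = j \<bar> \<forall>m\<le>n. X m \<omega> = x m) = P (x n) j)"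

text \<open>The infimum of the empty set is \<open>\<infinity>\<close> in \<^typ>\<open>enat\<close>.\<close>

definition return_time :: "(nat \<Rightarrow> 'w \<Rightarrow> 'a) \<Rightarrow> 'a \<Rightarrow> 'w \<Rightarrow> enat" where
  "return_time X k \<omega> = Inf {enat n |n. n \<ge> 1 \<and> X n \<omega> = k}"

text \<open>
  The vector $u$; the range $0 \le n \le \tau_k^+ - 1$ of the sum is written as $n < \tau_k^+$, which
  covers $\tau_k^+ = \infty$.
\<close>

definition excursion_vector ::
  "'w measure \<Rightarrow> (nat \<Rightarrow> 'w \<Rightarrow> 'a) \<Rightarrow> ('a \<Rightarrow> 'a \<Rightarrow> real) \<Rightarrow> ennreal \<Rightarrow> 'a \<Rightarrow> 'a \<Rightarrow> ennreal" where
  "excursion_vector M X A R k i =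
     (\<integral>\<^sup>+ \<omega>. (\<Sum>\<^sub>\<infinity>n | enat n < return_time X k \<omega>.
        indicator {i} (X n \<omega>) * R ^ n * (\<Prod>m<n. row_sum A (X m \<omega>))) \<partial>M)"


lemma infsum_ennreal_eq_nn_integral:
  fixes f :: "'a::countable \<Rightarrow> ennreal"
  shows "infsum f UNIV = (\<integral>\<^sup>+ x. f x \<partial>count_space UNIV)"
proof (rule antisym)
  have S: "infsum f UNIV = (SUP F\<in>{F. finite F \<and> F \<subseteq> UNIV}. sum f F)"
    by (rule nonneg_infsum_complete) simp
  show "infsum f UNIV \<le> (\<integral>\<^sup>+ x. f x \<partial>count_space UNIV)"
    unfolding S
  proof (rule SUP_least)
    fix F :: "'a set" assume "F \<in> {F. finite F \<and> F \<subseteq> UNIV}"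
    then have "finite F" by simp
    then have "sum f F = (\<integral>\<^sup>+ x. f x * indicator F x \<partial>count_space UNIV)"
      by (subst nn_integral_count_space'[of F]) (auto simp: indicator_def)
    also have "\<dots> \<le> (\<integral>\<^sup>+ x. f x \<partial>count_space UNIV)"
      by (intro nn_integral_mono) (auto simp: indicator_def)
    finally show "sum f F \<le> (\<integral>\<^sup>+ x. f x \<partial>count_space UNIV)" .
  qed
  define g where "g n = (if n \<in> range (to_nat :: 'a \<Rightarrow> nat) then f (from_nat n) else 0)" for n
  have "(\<integral>\<^sup>+ x. f x \<partial>count_space UNIV) = (\<integral>\<^sup>+ x. g (to_nat (x::'a)) \<partial>count_space UNIV)"
    by (intro nn_integral_cong) (simp add: g_def)
  also have "\<dots> = (\<integral>\<^sup>+ n. g n \<partial>count_space (range (to_nat :: 'a \<Rightarrow> nat)))"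
    by (rule nn_integral_bij_count_space) (simp add: bij_betw_def)
  also have "\<dots> = (\<integral>\<^sup>+ n. g n * indicator (range (to_nat :: 'a \<Rightarrow> nat)) n \<partial>count_space UNIV)"
    by (simp add: nn_integral_count_space_indicator)
  also have "\<dots> = (\<integral>\<^sup>+ n. g n \<partial>count_space UNIV)"
    by (intro nn_integral_cong) (auto simp: g_def indicator_def)
  also have "\<dots> = (\<Sum>n. g n)"
    by (rule nn_integral_count_space_nat)
  also have "\<dots> = (SUP N. \<Sum>n<N. g n)"
    by (rule suminf_eq_SUP)
  also have "\<dots> \<le> infsum f UNIV"
  proof (rule SUP_least)
    fix N
    define F where "F = {x::'a. to_nat x < N}"
    have fin: "finite F"
      unfolding F_def by (rule finite_imageD[of to_nat])
        (auto intro: finite_subset[of _ "{..<N}"] simp: inj_on_def)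
    have "(\<Sum>n<N. g n) = (\<Sum>n\<in>to_nat ` F. g n)"
      by (intro sum.mono_neutral_right) (auto simp: F_def g_def)
    also have "\<dots> = sum f F"
      by (subst sum.reindex) (auto simp: g_def inj_on_def intro!: sum.cong)
    also have "\<dots> \<le> infsum f UNIV"
      unfolding S using fin by (intro SUP_upper) auto
    finally show "(\<Sum>n<N. g n) \<le> infsum f UNIV" .
  qed
  finally show "(\<integral>\<^sup>+ x. f x \<partial>count_space UNIV) \<le> infsum f UNIV" .
qed

lemma mat_pow_add:
  fixes A :: "'a::countable \<Rightarrow> 'a \<Rightarrow> real"
  shows "mat_pow A (m + n) i j = (\<integral>\<^sup>+ l. mat_pow A m i l * mat_pow A n l j \<partial>count_space UNIV)"
proof (induction n arbitrary: j)
  case 0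
  have "(\<integral>\<^sup>+ l. mat_pow A m i l * mat_pow A 0 l j \<partial>count_space UNIV)
      = (\<Sum>l\<in>{j}. mat_pow A m i l * mat_pow A 0 l j)"
    by (rule nn_integral_count_space') auto
  then show ?case by simp
next
  case (Suc n)
  interpret pair_sigma_finite "count_space (UNIV::'a set)" "count_space (UNIV::'a set)"
    by (simp add: pair_sigma_finite_def sigma_finite_measure_count_space)
  have "mat_pow A (m + Suc n) i j
      = (\<integral>\<^sup>+ h. (\<integral>\<^sup>+ l. mat_pow A m i l * mat_pow A n l h \<partial>count_space UNIV) * ennreal (A h j)
          \<partial>count_space UNIV)"
    by (simp add: infsum_ennreal_eq_nn_integral Suc)
  also have "\<dots> = (\<integral>\<^sup>+ h. (\<integral>\<^sup>+ l. mat_pow A m i l * (mat_pow A n l h * ennreal (A h j))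
          \<partial>count_space UNIV) \<partial>count_space UNIV)"
    by (simp add: nn_integral_multc[symmetric] mult.assoc)
  also have "\<dots> = (\<integral>\<^sup>+ l. (\<integral>\<^sup>+ h. mat_pow A m i l * (mat_pow A n l h * ennreal (A h j))
          \<partial>count_space UNIV) \<partial>count_space UNIV)"
    by (intro Fubini') (simp add: pair_measure_countable)
  also have "\<dots> = (\<integral>\<^sup>+ l. mat_pow A m i l * mat_pow A (Suc n) l j \<partial>count_space UNIV)"
    by (simp add: nn_integral_cmult infsum_ennreal_eq_nn_integral)
  finally show ?case .
qed

lemma mat_pow_add_ge:
  fixes A :: "'a::countable \<Rightarrow> 'a \<Rightarrow> real"
  shows "mat_pow A m i l * mat_pow A n l j \<le> mat_pow A (m + n) i j"
proof -
  have "mat_pow A m i l * mat_pow A n l j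
      = (\<integral>\<^sup>+ h. mat_pow A m i h * mat_pow A n h j * indicator {l} h \<partial>count_space UNIV)"
    by (simp add: nn_integral_count_space_indicator[symmetric])
  also have "\<dots> \<le> (\<integral>\<^sup>+ h. mat_pow A m i h * mat_pow A n h j \<partial>count_space UNIV)"
    by (intro nn_integral_mono) (auto simp: indicator_def)
  finally show ?thesis by (simp add: mat_pow_add)
qed

lemma green_infinite_transfer:
  fixes A :: "'a::countable \<Rightarrow> 'a \<Rightarrow> real"
  assumes irr: "irreducible_matrix A" and inf: "green A r i j = \<infinity>"
  shows "green A r k l = \<infinity>"
proof -
  obtain p where p: "0 < mat_pow A p k i" using irr unfolding irreducible_matrix_def by blast
  obtain q where q: "0 < mat_pow A q j l" using irr unfolding irreducible_matrix_def by blast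
  have "r \<noteq> 0"
  proof
    assume "r = 0"
    have "green A 0 i j = (\<Sum>n\<in>{0}. 0 ^ n * mat_pow A n i j)"
      unfolding green_def by (rule suminf_finite) auto
    then have "green A 0 i j < \<infinity>" by simp
    then show False using inf \<open>r = 0\<close> by simp
  qed
  define c where "c = r ^ (p + q) * (mat_pow A p k i * mat_pow A q j l)"
  have "c \<noteq> 0" using \<open>r \<noteq> 0\<close> p q by (auto simp: c_def)
  have "\<infinity> = c * green A r i j"
    using inf \<open>c \<noteq> 0\<close> by (simp add: ennreal_mult_eq_top_iff)
  also have "\<dots> = (\<Sum>n. c * (r ^ n * mat_pow A n i j))"
    by (simp add: green_def)
  also have "\<dots> \<le> (\<Sum>n. r ^ (n + (p + q)) * mat_pow A (n + (p + q)) k l)"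
  proof (intro suminf_le allI)
    fix n
    have "mat_pow A p k i * mat_pow A n i j * mat_pow A q j l \<le> mat_pow A (p + n) k j * mat_pow A q j l"
      by (intro mult_right_mono mat_pow_add_ge) simp
    also have "\<dots> \<le> mat_pow A (p + n + q) k l"
      by (rule mat_pow_add_ge)
    finally have "r ^ (n + (p + q)) * (mat_pow A p k i * mat_pow A n i j * mat_pow A q j l)
        \<le> r ^ (n + (p + q)) * mat_pow A (n + (p + q)) k l"
      by (intro mult_left_mono) (simp_all add: ac_simps)
    then show "c * (r ^ n * mat_pow A n i j) \<le> r ^ (n + (p + q)) * mat_pow A (n + (p + q)) k l"
      by (simp add: c_def power_add ac_simps)
  qed auto
  also have "\<dots> \<le> green A r k l"
    unfolding green_def
  proof (rule suminf_le_const)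
    fix N
    let ?g = "\<lambda>n. r ^ n * mat_pow A n k l"
    have "(\<Sum>n<N. ?g (n + (p + q))) = sum ?g ((\<lambda>n. n + (p + q)) ` {..<N})"
      by (subst sum.reindex) (simp_all add: inj_on_def)
    also have "\<dots> \<le> suminf ?g"
      by (intro sum_le_suminf) auto
    finally show "(\<Sum>n<N. ?g (n + (p + q))) \<le> suminf ?g" .
  qed simp
  finally show ?thesis by (simp add: top_unique)
qed

lemma convergence_parameter_indep:
  fixes A :: "'a::countable \<Rightarrow> 'a \<Rightarrow> real"
  assumes "irreducible_matrix A"
  shows "convergence_parameter A i j = convergence_parameter A k l"
  using green_infinite_transfer[OF assms] unfolding convergence_parameter_def by metis

lemma green_mono: "r \<le> s \<Longrightarrow> green A r i j \<le> green A s i j"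
  unfolding green_def by (intro suminf_le allI mult_right_mono power_mono) auto

lemma convergence_parameter_eq_Sup:
  "convergence_parameter A i j = Sup {r. r < \<infinity> \<and> green A r i j < \<infinity>}"
proof (rule antisym)
  show "Sup {r. r < \<infinity> \<and> green A r i j < \<infinity>} \<le> convergence_parameter A i j"
    unfolding convergence_parameter_def
  proof (intro Sup_least Inf_greatest)
    fix r s
    assume "r \<in> {r. r < \<infinity> \<and> green A r i j < \<infinity>}" "s \<in> {r. r < \<infinity> \<and> green A r i j = \<infinity>}"
    then have "\<not> green A s i j \<le> green A r i j" by (simp add: not_le)
    then have "\<not> s \<le> r" using green_mono[of s r A i j] by auto
    then show "r \<le> s" by simp
  qed
  show "convergence_parameter A i j \<le> Sup {r. r < \<infinity> \<and> green A r i j < \<infinity>}"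
  proof (rule ccontr)
    assume "\<not> ?thesis"
    then have "Sup {r. r < \<infinity> \<and> green A r i j < \<infinity>} < convergence_parameter A i j"
      by (simp only: not_le)
    from dense[OF this] obtain s
      where s: "Sup {r. r < \<infinity> \<and> green A r i j < \<infinity>} < s" "s < convergence_parameter A i j"
      by (elim exE conjE)
    have "s < \<infinity>" using less_le_trans[OF s(2) top_greatest] by simp
    show False
    proof (cases "green A s i j = \<infinity>")
      case True
      then have "convergence_parameter A i j \<le> s"
        unfolding convergence_parameter_def using \<open>s < \<infinity>\<close> by (intro Inf_lower) simp
      then show False using s(2) by simp
    next
      case False
      then have "s \<le> Sup {r. r < \<infinity> \<and> green A r i j < \<infinity>}"
        using \<open>s < \<infinity>\<close> by (intro Sup_upper) (simp add: less_top)
      then show False using s(1) by simp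
    qed
  qed
qed

end

theory Submission
  imports Defs
begin

text \<open>
  By the Markov property, the contribution of time $n$ to $u_i$ is $R^n$ times the total \<open>A\<close>-weight
  of the paths of length $n$ from $k$ to $i$ that do not return to $k$. Hence $R\,(uA)_j = u_j$ for
  $j \neq k$ by extending such paths by one step, while $R\,(uA)_k$ is the generating function
  $F(R)$ of the first-return weights and $u_k = 1$. The renewal equation $G = 1 + G F$ for the Green
  function $G(r)$ at $(k,k)$ gives $F(r) \le 1$ for $r < R$; letting $r$ increase to $R$,
  $R$-recurrence forces $F(R) = 1$. Positivity and finiteness of $u$ follow from $u A^n = R^{-n} u$,
  irreducibility and $u_k = 1$.
\<close>

section \<open>Series of extended non-negative reals\<close>

text \<open>A partial sum with fewer than \<open>N + 1\<close> terms loses at most the factor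
  \<open>t ^ N\<close> when \<open>R\<close> is replaced by \<open>t * R < R\<close>, since
  \<open>t ^ N \<le> t ^ n\<close> for \<open>n < N\<close>. Letting \<open>t\<close> increase to 1
  bounds every partial sum at \<open>R\<close>. This is how bounds below the convergence parameter
  are carried to the parameter itself.\<close>

lemma ennreal_power_series_le_left:
  fixes c :: "nat \<Rightarrow> ennreal"
  assumes "R < \<infinity>" and le: "\<And>r. r < R \<Longrightarrow> (\<Sum>n. r ^ n * c n) \<le> b" and "0 < R"
  shows "(\<Sum>n. R ^ n * c n) \<le> b"
proof (rule suminf_le_const)
  fix N
  let ?S = "\<Sum>n<N. R ^ n * c n"
  have *: "ennreal t ^ N * ?S \<le> b" if "0 < t" "t < 1" for t :: real
  proof -
    have "ennreal t ^ N * ?S = (\<Sum>n<N. ennreal t ^ N * (R ^ n * c n))"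
      by (simp add: sum_distrib_left)
    also have "\<dots> \<le> (\<Sum>n<N. (ennreal t * R) ^ n * c n)"
    proof (rule sum_mono)
      fix n assume "n \<in> {..<N}"
      then have "ennreal t ^ N \<le> ennreal t ^ n"
        using that by (intro power_decreasing) auto
      then show "ennreal t ^ N * (R ^ n * c n) \<le> (ennreal t * R) ^ n * c n"
        by (auto simp: power_mult_distrib mult.assoc intro!: mult_right_mono)
    qed
    also have "\<dots> \<le> (\<Sum>n. (ennreal t * R) ^ n * c n)"
      by (intro sum_le_suminf) auto
    also have "\<dots> \<le> b"
    proof (rule le)
      have "ennreal t * R < 1 * R"
        using that assms by (intro ennreal_mult_strict_right_mono) auto
      then show "ennreal t * R < R" by simp
    qed
    finally show ?thesis .
  qed
  show "?S \<le> b"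
  proof (rule tendsto_upperbound)
    \<comment> \<open>The first factor tends to 1, which is neither 0 nor infinite, so the product
      converges even when \<open>?S\<close> is infinite.\<close>
    have "((\<lambda>t. ennreal (t ^ N) * ?S) \<longlongrightarrow> ennreal (1 ^ N) * ?S) (at_left 1)"
      by (intro tendsto_mult_ennreal tendsto_ennrealI tendsto_intros) auto
    then show "((\<lambda>t. ennreal (t ^ N) * ?S) \<longlongrightarrow> ?S) (at_left 1)" by simp
    have "eventually (\<lambda>t. t \<in> {0<..<1}) (at_left (1::real))"
      by (rule eventually_at_left_real) simp
    then show "\<forall>\<^sub>F t in at_left 1. ennreal (t ^ N) * ?S \<le> b"
      by eventually_elim (use * in \<open>auto simp: ennreal_power\<close>)
  qed simp
qed simp

lemma ennreal_suminf_swap: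
  fixes f :: "nat \<Rightarrow> nat \<Rightarrow> ennreal"
  shows "(\<Sum>n. \<Sum>m. f n m) = (\<Sum>m. \<Sum>n. f n m)"
proof -
  have "(\<Sum>n. \<Sum>m. f n m) = (\<integral>\<^sup>+ n. (\<Sum>m. f n m) \<partial>count_space UNIV)"
    by (simp add: nn_integral_count_space_nat)
  also have "\<dots> = (\<Sum>m. \<integral>\<^sup>+ n. f n m \<partial>count_space UNIV)"
    by (intro nn_integral_suminf) simp
  finally show ?thesis by (simp add: nn_integral_count_space_nat)
qed

lemma ennreal_suminf_shift:
  fixes f :: "nat \<Rightarrow> ennreal"
  shows "(\<Sum>n. if m \<le> n then f (n - m) else 0) = (\<Sum>n. f n)"
  by (subst suminf_offset[where i = m]) simp_all

lemma ennreal_suminf_Suc: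
  fixes f :: "nat \<Rightarrow> ennreal"
  shows "(\<Sum>n. f n) = f 0 + (\<Sum>n. f (Suc n))"
  by (subst suminf_offset[where i = 1]) (simp_all add: add.commute)

text \<open>Padding the triangle \<open>m \<le> n\<close> with zeros gives a full double series.
  After the exchange of sums, each inner series is a shifted copy of \<open>f\<close>. Infinite sums
  are allowed.\<close>

lemma ennreal_Cauchy_product:
  fixes f g :: "nat \<Rightarrow> ennreal"
  shows "(\<Sum>n. \<Sum>m\<le>n. f (n - m) * g m) = (\<Sum>n. f n) * (\<Sum>n. g n)"
proof -
  have "(\<Sum>n. \<Sum>m\<le>n. f (n - m) * g m) = (\<Sum>n. \<Sum>m. (if m \<le> n then f (n - m) else 0) * g m)"
    by (intro suminf_cong, subst suminf_finite[of "{.._}"]) auto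
  also have "\<dots> = (\<Sum>m. \<Sum>n. (if m \<le> n then f (n - m) else 0) * g m)"
    by (rule ennreal_suminf_swap)
  also have "\<dots> = (\<Sum>m. (\<Sum>n. f n) * g m)"
    by (simp only: ennreal_suminf_multc ennreal_suminf_shift)
  finally show ?thesis by simp
qed


section \<open>Last exits, renewal equation and the value of the first-return series at
  \<open>R\<close>\<close>

text \<open>The total weight of the paths of length \<open>n\<close> from \<open>k\<close> that avoid \<open>k\<close> at the times \<open>1, \<dots>, n\<close>.\<close>

primrec taboo_weight :: "('a \<Rightarrow> 'a \<Rightarrow> real) \<Rightarrow> 'a \<Rightarrow> nat \<Rightarrow> 'a \<Rightarrow> ennreal" where
  "taboo_weight A k 0 = (\<lambda>i. if i = k then 1 else 0)"
| "taboo_weight A k (Suc n) =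
    (\<lambda>j. if j = k then 0 else \<integral>\<^sup>+ i. taboo_weight A k n i * ennreal (A i j) \<partial>count_space UNIV)"

text \<open>The index is shifted: this is the weight of the first returns at time \<open>n + 1\<close>.\<close>

definition first_return_weight :: "('a \<Rightarrow> 'a \<Rightarrow> real) \<Rightarrow> 'a \<Rightarrow> nat \<Rightarrow> ennreal" where
  "first_return_weight A k n =
    (\<integral>\<^sup>+ i. taboo_weight A k n i * ennreal (A i k) \<partial>count_space UNIV)"

text \<open>Paths are split at their last visit to \<open>k\<close>, at time \<open>n - m\<close>;
  the remaining \<open>m\<close> steps avoid \<open>k\<close>. In the second identity the last visit
  is taken among the times up to \<open>n\<close> and the final step to \<open>j\<close> is
  unrestricted, so that \<open>j = k\<close> produces first-return weights.\<close>

lemma mat_pow_last_exit: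
  fixes A :: "'a::countable \<Rightarrow> 'a \<Rightarrow> real"
  shows "mat_pow A n k j = (\<Sum>m\<le>n. mat_pow A (n - m) k k * taboo_weight A k m j)"
    and "mat_pow A (Suc n) k j =
      (\<Sum>m\<le>n. mat_pow A (n - m) k k * (\<integral>\<^sup>+ i. taboo_weight A k m i * ennreal (A i j) \<partial>count_space UNIV))"
proof -
  \<comment> \<open>Stated as an implication from length \<open>n\<close>, because it serves both
    the induction and the second claim.\<close>
  have step: "mat_pow A (Suc n) k j =
      (\<Sum>m\<le>n. mat_pow A (n - m) k k * (\<integral>\<^sup>+ i. taboo_weight A k m i * ennreal (A i j) \<partial>count_space UNIV))"
    if "\<And>j. mat_pow A n k j = (\<Sum>m\<le>n. mat_pow A (n - m) k k * taboo_weight A k m j)" for n j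
    by (simp add: infsum_ennreal_eq_nn_integral that sum_distrib_right nn_integral_sum
        mult.assoc nn_integral_cmult)
  have *: "mat_pow A n k j = (\<Sum>m\<le>n. mat_pow A (n - m) k k * taboo_weight A k m j)" for n j
  proof (induction n arbitrary: j)
    case 0
    then show ?case by simp
  next
    case (Suc n)
    show ?case
    \<comment> \<open>For \<open>j = k\<close> only the term \<open>m = 0\<close> survives and the
      identity is trivial. For \<open>j \<noteq> k\<close> that term vanishes and the shifted sum is
      \<open>step\<close>.\<close>
    proof (cases "j = k")
      case True
      then show ?thesis by (subst sum.atMost_Suc_shift) (simp del: mat_pow.simps)
    next
      case False
      then show ?thesis
        unfolding step[OF Suc] by (subst sum.atMost_Suc_shift) (simp del: mat_pow.simps)
    qed
  qed
  show "mat_pow A n k j = (\<Sum>m\<le>n. mat_pow A (n - m) k k * taboo_weight A k m j)"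
    by (rule *)
  show "mat_pow A (Suc n) k j =
      (\<Sum>m\<le>n. mat_pow A (n - m) k k * (\<integral>\<^sup>+ i. taboo_weight A k m i * ennreal (A i j) \<partial>count_space UNIV))"
    by (rule step[OF *])
qed

text \<open>The last-exit identity at \<open>j = k\<close>, with \<open>r ^ Suc n\<close> split as
  \<open>r ^ (n - m) * r ^ Suc m\<close>, is a Cauchy product. Both sides may be infinite, so
  nothing can be cancelled yet.\<close>

lemma green_renewal:
  fixes A :: "'a::countable \<Rightarrow> 'a \<Rightarrow> real"
  shows "green A r k k = 1 + green A r k k * (\<Sum>n. r ^ Suc n * first_return_weight A k n)"
proof -
  have "green A r k k = 1 + (\<Sum>n. r ^ Suc n * mat_pow A (Suc n) k k)"
    unfolding green_def by (subst ennreal_suminf_Suc) simp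
  also have "(\<Sum>n. r ^ Suc n * mat_pow A (Suc n) k k) =
      (\<Sum>n. \<Sum>m\<le>n. (r ^ (n - m) * mat_pow A (n - m) k k) * (r ^ Suc m * first_return_weight A k m))"
    unfolding mat_pow_last_exit(2) sum_distrib_left first_return_weight_def[symmetric]
  proof (intro suminf_cong sum.cong refl)
    fix n m :: nat assume "m \<in> {..n}"
    then have "Suc n = (n - m) + Suc m" by simp
    then have "r ^ Suc n = r ^ (n - m) * r ^ Suc m" by (metis power_add)
    then show "r ^ Suc n * (mat_pow A (n - m) k k * first_return_weight A k m) =
        r ^ (n - m) * mat_pow A (n - m) k k * (r ^ Suc m * first_return_weight A k m)"
      by (simp only: ac_simps)
  qed
  also have "\<dots> = green A r k k * (\<Sum>n. r ^ Suc n * first_return_weight A k n)"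
    unfolding green_def by (rule ennreal_Cauchy_product)
  finally show ?thesis .
qed

text \<open>A loop at \<open>k\<close> of length \<open>n\<close> and weight \<open>c > 0\<close>
  can be repeated. If \<open>r ^ n * c \<ge> 1\<close>, then each multiple of \<open>n\<close>
  contributes at least 1 to the Green function, which therefore diverges at the finite value
  \<open>r\<close>.\<close>

lemma convergence_parameter_finite:
  fixes A :: "'a::countable \<Rightarrow> 'a \<Rightarrow> real"
  assumes "irreducible_matrix A"
  shows "convergence_parameter A k k < \<infinity>"
proof -
  obtain n where "n \<ge> 1" and pos: "0 < mat_pow A n k k"
    using assms unfolding irreducible_matrix_def by blast
  define c where "c = mat_pow A n k k"
  \<comment> \<open>The bound \<open>1 / c\<close> gives \<open>r * c \<ge> 1\<close> when
    \<open>c < 1\<close>; the bound 1 gives \<open>r \<le> r ^ n\<close>, and it suffices alone when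
    \<open>c \<ge> 1\<close>, including infinite \<open>c\<close>.\<close>
  define r where "r = max 1 (1 / c)"
  have "r < \<infinity>"
    using pos by (auto simp: r_def c_def max_def less_top[symmetric] ennreal_divide_eq_top_iff)
  have "1 \<le> r * c"
  proof (cases "c < 1")
    case True
    then have "c < \<infinity>" using less_trans[of c 1 top] by simp
    then have "1 / c * c = 1"
      using pos by (auto simp: c_def ennreal_divide_times intro!: ennreal_divide_self)
    then have "1 = 1 / c * c" by simp
    also have "\<dots> \<le> r * c" by (intro mult_right_mono) (auto simp: r_def)
    finally show ?thesis .
  next
    case False
    then show ?thesis using mult_mono[of 1 r 1 c] by (auto simp: r_def)
  qed
  also have "\<dots> \<le> r ^ n * c"
    using power_increasing[of 1 n r] \<open>n \<ge> 1\<close> by (intro mult_right_mono) (auto simp: r_def)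
  finally have rc: "1 \<le> r ^ n * c" .
  have ge: "1 \<le> r ^ (n * m) * mat_pow A (n * m) k k" for m
  proof (induction m)
    case 0
    then show ?case by simp
  next
    case (Suc m)
    have "1 * 1 \<le> (r ^ n * c) * (r ^ (n * m) * mat_pow A (n * m) k k)"
      by (intro mult_mono rc Suc) auto
    also have "\<dots> = r ^ (n * Suc m) * (mat_pow A n k k * mat_pow A (n * m) k k)"
      by (simp add: c_def power_add ac_simps)
    also have "\<dots> \<le> r ^ (n * Suc m) * mat_pow A (n * Suc m) k k"
      using mat_pow_add_ge[of A n k k "n * m" k] by (intro mult_left_mono) auto
    finally show ?case by simp
  qed
  have "of_nat N \<le> green A r k k" for N
  proof -
    have "of_nat N = (\<Sum>m<N. 1 :: ennreal)" by simp
    also have "\<dots> \<le> (\<Sum>m<N. r ^ (n * m) * mat_pow A (n * m) k k)"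
      by (intro sum_mono ge)
    also have "\<dots> = (\<Sum>i\<in>(\<lambda>m. n * m) ` {..<N}. r ^ i * mat_pow A i k k)"
      using \<open>n \<ge> 1\<close> by (subst sum.reindex) (auto simp: inj_on_def)
    also have "\<dots> \<le> green A r k k"
      unfolding green_def by (intro sum_le_suminf) auto
    finally show ?thesis .
  qed
  then have "green A r k k = \<infinity>"
    using ennreal_SUP_of_nat_eq_top by (metis SUP_least infinity_ennreal_def top_unique)
  with \<open>r < \<infinity>\<close> have "convergence_parameter A k k \<le> r"
    unfolding convergence_parameter_def by (intro Inf_lower) simp
  with \<open>r < \<infinity>\<close> show ?thesis by (rule le_less_trans[rotated])
qed

text \<open>Finiteness of \<open>g\<close> permits cancellation: \<open>f > 1\<close> would give
  \<open>1 + g \<le> g\<close>. Since subtraction is truncated in \<open>ennreal\<close>,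
  \<open>f \<le> 1\<close> has to come before the identity with \<open>1 - f\<close>.\<close>

lemma ennreal_renewal_solution:
  fixes g f :: ennreal
  assumes "g = 1 + g * f" "g < \<infinity>"
  shows "f \<le> 1" and "g * (1 - f) = 1"
proof -
  have "1 \<le> g" using assms(1) by (metis le_iff_add)
  show "f \<le> 1"
  proof (rule ccontr)
    assume "\<not> f \<le> 1"
    then have "g * 1 \<le> g * f" by (intro mult_left_mono) auto
    then have "1 + g \<le> 1 + g * f" by (intro add_left_mono) simp
    then have "1 + g \<le> 0 + g" using assms(1) by simp
    then show False using assms(2) by (metis add.commute ennreal_add_left_cancel_le infinity_ennreal_def less_irrefl not_one_le_zero)
  qed
  then show "g * (1 - f) = 1"
  proof -
    have "g * f < \<infinity>" using assms by (metis ennreal_add_less_top infinity_ennreal_def)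
    have "g * (1 - f) + g * f = g * ((1 - f) + f)" by (simp add: distrib_left)
    also have "\<dots> = 1 + g * f" using \<open>f \<le> 1\<close> assms(1) by (simp add: diff_add_cancel_ennreal)
    finally show ?thesis using \<open>g * f < \<infinity>\<close>
      by (metis add.commute ennreal_add_left_cancel less_irrefl)
  qed
qed

text \<open>Below \<open>R\<close> the Green function is finite, so the renewal equation bounds the
  first-return series by 1, and this bound passes to \<open>R\<close>. A value below 1 at
  \<open>R\<close> would bound the Green function uniformly below \<open>R\<close>, hence also at
  \<open>R\<close>, against recurrence.\<close>

lemma first_return_weight_sum_eq_1:
  fixes A :: "'a::countable \<Rightarrow> 'a \<Rightarrow> real"
  assumes "R_recurrent A R" "0 < R" "R < \<infinity>"
  shows "(\<Sum>n. R ^ Suc n * first_return_weight A k n) = 1"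
proof -
  define F where "F r = (\<Sum>n. r ^ Suc n * first_return_weight A k n)" for r
  \<comment> \<open>A zero constant coefficient absorbs the index shift, giving the form
    \<open>r ^ n * c n\<close> needed for the passage to \<open>R\<close>.\<close>
  have F_alt: "F r = (\<Sum>n. r ^ n * (case n of 0 \<Rightarrow> 0 | Suc n \<Rightarrow> first_return_weight A k n))" for r
    unfolding F_def by (subst (2) ennreal_suminf_Suc) simp
  have fin: "green A r k k < \<infinity>" if "r < R" for r
  proof (rule ccontr)
    assume "\<not> green A r k k < \<infinity>"
    then have "convergence_parameter A k k \<le> r"
      unfolding convergence_parameter_def
      using that by (intro Inf_lower) (auto simp: less_top[symmetric])
    then show False using assms(1) that by (auto simp: R_recurrent_def)
  qed
  have ren: "green A r k k = 1 + green A r k k * F r" for r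
    unfolding F_def by (rule green_renewal)
  have "F R \<le> 1"
    unfolding F_alt
    by (rule ennreal_power_series_le_left[OF assms(3) _ assms(2)])
      (use ennreal_renewal_solution(1)[OF ren fin] in \<open>simp add: F_alt\<close>)
  moreover have "\<not> F R < 1"
  proof
    assume "F R < 1"
    then have pos: "0 < 1 - F R" by (simp add: diff_gr0_ennreal)
    \<comment> \<open>By monotonicity \<open>F r \<le> F R\<close>, so \<open>1 / (1 - F R)\<close>
      is a bound independent of \<open>r\<close>.\<close>
    have "green A r k k \<le> 1 / (1 - F R)" if "r < R" for r
    proof -
      have "F r \<le> F R"
        unfolding F_def using that by (intro suminf_le allI mult_right_mono power_mono) auto
      then have "green A r k k * (1 - F R) \<le> green A r k k * (1 - F r)"
        by (intro mult_left_mono ennreal_minus_mono) auto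
      also have "\<dots> = 1" by (rule ennreal_renewal_solution(2)[OF ren fin[OF that]])
      finally show ?thesis
        using pos divide_right_mono_ennreal[of "green A r k k * (1 - F R)" 1 "1 - F R"]
        by (simp add: ennreal_mult_divide_eq)
    qed
    then have "green A R k k \<le> 1 / (1 - F R)"
      unfolding green_def by (rule ennreal_power_series_le_left[OF assms(3) _ assms(2)])
    also have "\<dots> < \<infinity>" using pos by (auto simp: ennreal_divide_eq_top_iff less_top[symmetric])
    finally show False using assms(1) by (simp add: R_recurrent_def)
  qed
  ultimately show ?thesis by (simp add: F_def)
qed


section \<open>The eigenvector equation, positivity and finiteness\<close>

lemma excursion_eigenvector:
  fixes A :: "'a::countable \<Rightarrow> 'a \<Rightarrow> real" and k :: 'a
  assumes "R_recurrent A R" "0 < R" "R < \<infinity>"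
  defines "v \<equiv> \<lambda>i. \<Sum>n. R ^ n * taboo_weight A k n i"
  shows "v k = 1"
    and "(\<integral>\<^sup>+ i. v i * ennreal (A i j) \<partial>count_space UNIV) = (1 / R) * v j"
proof -
  have at_k: "taboo_weight A k n k = (if n = 0 then 1 else 0)" for n
    by (cases n) auto
  have "v k = (\<Sum>n\<in>{0}. R ^ n * taboo_weight A k n k)"
    unfolding v_def by (rule suminf_finite) (auto simp: at_k)
  then show "v k = 1" by simp
  define w where "w n = (\<integral>\<^sup>+ i. taboo_weight A k n i * ennreal (A i j) \<partial>count_space UNIV)" for n
  \<comment> \<open>The factor \<open>R\<close> pairs the additional step with
    \<open>R ^ Suc n\<close>; division by \<open>R\<close> is postponed to the end, where
    \<open>R\<close> is known to be neither 0 nor infinite.\<close>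
  have "R * (\<integral>\<^sup>+ i. v i * ennreal (A i j) \<partial>count_space UNIV) =
      R * (\<integral>\<^sup>+ i. (\<Sum>n. R ^ n * (taboo_weight A k n i * ennreal (A i j))) \<partial>count_space UNIV)"
    by (simp add: v_def mult.assoc flip: ennreal_suminf_multc)
  also have "\<dots> = R * (\<Sum>n. R ^ n * w n)"
    by (subst nn_integral_suminf) (simp_all add: w_def nn_integral_cmult)
  also have "\<dots> = (\<Sum>n. R ^ Suc n * w n)"
    by (simp add: mult.assoc flip: ennreal_suminf_cmult)
  also have "\<dots> = v j"
  \<comment> \<open>At \<open>k\<close> the extended paths are the first returns, of total weight 1,
    which matches \<open>v k = 1\<close>. Elsewhere they are exactly the taboo paths of length
    \<open>Suc n\<close>, and the length-0 term of \<open>v j\<close> is zero.\<close>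
  proof (cases "j = k")
    case True
    then show ?thesis
      using first_return_weight_sum_eq_1[OF assms(1-3), of k] \<open>v k = 1\<close>
      by (simp only: w_def first_return_weight_def)
  next
    case False
    then have "v j = (\<Sum>n. R ^ Suc n * taboo_weight A k (Suc n) j)"
      unfolding v_def by (subst ennreal_suminf_Suc) simp
    then show ?thesis using False by (simp add: w_def)
  qed
  finally have *: "v j = R * (\<integral>\<^sup>+ i. v i * ennreal (A i j) \<partial>count_space UNIV)" ..
  have "1 / R * R = 1"
    using assms(2,3) by (simp add: ennreal_divide_times ennreal_divide_self)
  then show "(\<integral>\<^sup>+ i. v i * ennreal (A i j) \<partial>count_space UNIV) = (1 / R) * v j"
    unfolding * by (simp flip: mult.assoc)
qed

lemma left_eigenvector_mat_pow:
  fixes A :: "'a::countable \<Rightarrow> 'a \<Rightarrow> real" and v :: "'a \<Rightarrow> ennreal"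
  assumes eig: "\<And>j. (\<integral>\<^sup>+ i. v i * ennreal (A i j) \<partial>count_space UNIV) = c * v j"
  shows "(\<integral>\<^sup>+ i. v i * mat_pow A n i j \<partial>count_space UNIV) = c ^ n * v j"
proof (induction n arbitrary: j)
  case 0
  have "(\<integral>\<^sup>+ i. v i * mat_pow A 0 i j \<partial>count_space UNIV) = (\<Sum>i\<in>{j}. v i * mat_pow A 0 i j)"
    by (rule nn_integral_count_space') auto
  then show ?case by simp
next
  case (Suc n)
  interpret pair_sigma_finite "count_space (UNIV::'a set)" "count_space (UNIV::'a set)"
    by (simp add: pair_sigma_finite_def sigma_finite_measure_count_space)
  have "(\<integral>\<^sup>+ i. v i * mat_pow A (Suc n) i j \<partial>count_space UNIV) =
      (\<integral>\<^sup>+ i. (\<integral>\<^sup>+ l. v i * mat_pow A n i l * ennreal (A l j) \<partial>count_space UNIV) \<partial>count_space UNIV)"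
    by (simp add: infsum_ennreal_eq_nn_integral mult.assoc nn_integral_cmult)
  also have "\<dots> =
      (\<integral>\<^sup>+ l. (\<integral>\<^sup>+ i. v i * mat_pow A n i l * ennreal (A l j) \<partial>count_space UNIV) \<partial>count_space UNIV)"
    by (intro Fubini'[symmetric]) (simp add: pair_measure_countable)
  also have "\<dots> = c ^ n * (\<integral>\<^sup>+ l. v l * ennreal (A l j) \<partial>count_space UNIV)"
    by (simp add: nn_integral_multc Suc) (simp add: mult.assoc nn_integral_cmult)
  also have "\<dots> = c ^ Suc n * v j"
    by (simp add: eig ac_simps)
  finally show ?case .
qed

text \<open>A single term of the eigenvector equation for the power \<open>n\<close> gives
  \<open>v i * mat_pow A n i j \<le> c ^ n * v j\<close>. A path from \<open>k\<close> to
  \<open>i\<close> transfers positivity to \<open>v i\<close>; a path from \<open>i\<close> to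
  \<open>k\<close> transfers finiteness.\<close>

lemma irreducible_left_eigenvector_pos_finite:
  fixes A :: "'a::countable \<Rightarrow> 'a \<Rightarrow> real" and v :: "'a \<Rightarrow> ennreal"
  assumes irr: "irreducible_matrix A"
    and eig: "\<And>j. (\<integral>\<^sup>+ i. v i * ennreal (A i j) \<partial>count_space UNIV) = c * v j"
    and c: "c < \<infinity>" and k: "0 < v k" "v k < \<infinity>"
  shows "0 < v i" and "v i < \<infinity>"
proof -
  have le: "v i * mat_pow A n i j \<le> c ^ n * v j" for n i j
  proof -
    have "v i * mat_pow A n i j =
        (\<integral>\<^sup>+ h. v h * mat_pow A n h j * indicator {i} h \<partial>count_space UNIV)"
      by (simp add: nn_integral_count_space_indicator[symmetric])
    also have "\<dots> \<le> (\<integral>\<^sup>+ h. v h * mat_pow A n h j \<partial>count_space UNIV)"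
      by (intro nn_integral_mono) (auto simp: indicator_def)
    finally show ?thesis by (simp add: left_eigenvector_mat_pow[OF eig])
  qed
  obtain m where m: "0 < mat_pow A m k i" using irr unfolding irreducible_matrix_def by blast
  obtain n where n: "0 < mat_pow A n i k" using irr unfolding irreducible_matrix_def by blast
  have "0 < v k * mat_pow A m k i" using k(1) m by (simp add: ennreal_zero_less_mult_iff)
  also have "\<dots> \<le> c ^ m * v i" by (rule le)
  finally show "0 < v i" by (simp add: ennreal_zero_less_mult_iff)
  have "v i * mat_pow A n i k \<le> c ^ n * v k" by (rule le)
  also have "\<dots> < \<infinity>"
    using c k(2) by (simp add: ennreal_mult_less_top power_less_top_ennreal)
  finally show "v i < \<infinity>"
    using n by (auto simp: less_top[symmetric] ennreal_mult_eq_top_iff)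
qed


section \<open>From expectations of the Markov chain to path weights\<close>

text \<open>The Markov property for an arbitrary functional of the path up to time \<open>n\<close>.
  Both sides integrate \<open>\<phi>\<close> against a law of that path weighted by a density, and
  the two laws agree on each single path by the defining conditional probabilities.\<close>

lemma markov_chain_step:
  fixes X :: "nat \<Rightarrow> 'w \<Rightarrow> 'a::countable" and \<phi> :: "'a list \<Rightarrow> ennreal"
  assumes mc: "markov_chain_from M X P k" and nonneg: "\<And>i j. 0 \<le> P i j"
  shows "(\<integral>\<^sup>+ \<omega>. \<phi> (map (\<lambda>m. X m \<omega>) [0..<Suc n]) * indicator {j} (X (Suc n) \<omega>) \<partial>M) =
    (\<integral>\<^sup>+ \<omega>. \<phi> (map (\<lambda>m. X m \<omega>) [0..<Suc n]) * ennreal (P (X n \<omega>) j) \<partial>M)"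
proof -
  interpret prob_space M using mc by (simp add: markov_chain_from_def)
  have X[measurable]: "X n \<in> measurable M (count_space UNIV)" for n
    using mc by (simp add: markov_chain_from_def)
  define Y where "Y \<omega> = map (\<lambda>m. X m \<omega>) [0..<Suc n]" for \<omega>
  have Y_eq: "Y \<omega> = ys \<longleftrightarrow> length ys = Suc n \<and> (\<forall>m\<le>n. X m \<omega> = ys ! m)" for \<omega> ys
    by (auto simp: Y_def list_eq_iff_nth_eq less_Suc_eq_le simp del: upt_Suc)
  have Y_meas[measurable]: "Y \<in> measurable M (count_space UNIV)"
  proof (subst measurable_count_space_eq2_countable, safe)
    fix ys :: "'a list"
    have "Y -` {ys} \<inter> space M = {\<omega>\<in>space M. length ys = Suc n \<and> (\<forall>m\<le>n. X m \<omega> = ys ! m)}"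
      by (simp add: vimage_def Y_eq Int_def conj_commute)
    also have "\<dots> \<in> sets M" by measurable
    finally show "Y -` {ys} \<inter> space M \<in> sets M" .
  qed auto
  define N1 where "N1 = distr (density M (\<lambda>\<omega>. indicator {j} (X (Suc n) \<omega>))) (count_space UNIV) Y"
  define N2 where "N2 = distr (density M (\<lambda>\<omega>. ennreal (P (X n \<omega>) j))) (count_space UNIV) Y"
  \<comment> \<open>The path up to time \<open>n\<close> takes values in a countable type, so singletons suffice.\<close>
  have "N1 = N2"
  proof (rule measure_eqI_countable[where A = UNIV])
    fix ys :: "'a list"
    have [measurable]: "Y -` {ys} \<inter> space M \<in> sets M"
      by (rule measurable_sets[OF Y_meas]) simp
    have N1: "emeasure N1 {ys} = (\<integral>\<^sup>+ \<omega>. indicator {j} (X (Suc n) \<omega>) * indicator {ys} (Y \<omega>) \<partial>M)"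
      unfolding N1_def
      by (auto simp: emeasure_distr emeasure_density intro!: nn_integral_cong split: split_indicator)
    have N2: "emeasure N2 {ys} = (\<integral>\<^sup>+ \<omega>. ennreal (P (X n \<omega>) j) * indicator {ys} (Y \<omega>) \<partial>M)"
      unfolding N2_def
      by (auto simp: emeasure_distr emeasure_density intro!: nn_integral_cong split: split_indicator)
    show "emeasure N1 {ys} = emeasure N2 {ys}"
    \<comment> \<open>Lists of any other length are never values of \<open>Y\<close> and have mass 0
      under both measures.\<close>
    proof (cases "length ys = Suc n")
      case False
      then have "indicator {ys} (Y \<omega>) = (0 :: ennreal)" for \<omega> by (auto simp: Y_eq)
      then show ?thesis unfolding N1 N2 by simp
    next
      case True
      let ?Q = "\<lambda>\<omega>. \<forall>m\<le>n. X m \<omega> = ys ! m"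
      have "emeasure N1 {ys} =
          (\<integral>\<^sup>+ \<omega>. indicator {\<omega>\<in>space M. X (Suc n) \<omega> = j \<and> ?Q \<omega>} \<omega> \<partial>M)"
        unfolding N1 using True by (intro nn_integral_cong) (simp add: Y_eq indicator_def)
      also have "\<dots> = emeasure M {\<omega>\<in>space M. X (Suc n) \<omega> = j \<and> ?Q \<omega>}"
        by (rule nn_integral_indicator) measurable
      also have "\<dots> = ennreal (\<P>(\<omega> in M. X (Suc n) \<omega> = j \<and> ?Q \<omega>))"
        by (rule emeasure_eq_measure)
      also have "\<P>(\<omega> in M. X (Suc n) \<omega> = j \<and> ?Q \<omega>) = P (ys ! n) j * \<P>(\<omega> in M. ?Q \<omega>)"
      \<comment> \<open>The chain property constrains only histories of positive probability; for
        null histories both sides are 0.\<close>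
      proof (cases "\<P>(\<omega> in M. ?Q \<omega>) > 0")
        case True
        then have "\<P>(\<omega> in M. X (Suc n) \<omega> = j \<bar> ?Q \<omega>) = P (ys ! n) j"
          using mc unfolding markov_chain_from_def by blast
        with True show ?thesis by (simp add: cond_prob_def field_simps)
      next
        case False
        then have 0: "\<P>(\<omega> in M. ?Q \<omega>) = 0" 
          using measure_nonneg[of M] by (simp add: not_less antisym)
        moreover have "\<P>(\<omega> in M. X (Suc n) \<omega> = j \<and> ?Q \<omega>) \<le> \<P>(\<omega> in M. ?Q \<omega>)"
          by (intro finite_measure_mono) auto
        ultimately show ?thesis using measure_nonneg[of M] by (simp add: antisym)
      qed
      also have "ennreal (P (ys ! n) j * \<P>(\<omega> in M. ?Q \<omega>)) =
          ennreal (P (ys ! n) j) * emeasure M {\<omega>\<in>space M. ?Q \<omega>}"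
        by (simp add: ennreal_mult nonneg emeasure_eq_measure)
      also have "\<dots> = (\<integral>\<^sup>+ \<omega>. ennreal (P (ys ! n) j) * indicator {\<omega>\<in>space M. ?Q \<omega>} \<omega> \<partial>M)"
        by (simp add: nn_integral_cmult_indicator)
      also have "\<dots> = emeasure N2 {ys}"
        unfolding N2 using True by (intro nn_integral_cong) (auto simp: Y_eq indicator_def)
      finally show ?thesis .
    qed
  qed (auto simp: N1_def N2_def)
  have "(\<integral>\<^sup>+ ys. \<phi> ys \<partial>N1) = (\<integral>\<^sup>+ \<omega>. \<phi> (Y \<omega>) * indicator {j} (X (Suc n) \<omega>) \<partial>M)"
    unfolding N1_def by (simp add: nn_integral_distr nn_integral_density mult.commute)
  moreover have "(\<integral>\<^sup>+ ys. \<phi> ys \<partial>N2) = (\<integral>\<^sup>+ \<omega>. \<phi> (Y \<omega>) * ennreal (P (X n \<omega>) j) \<partial>M)"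
    unfolding N2_def by (simp add: nn_integral_distr nn_integral_density mult.commute)
  ultimately show ?thesis using \<open>N1 = N2\<close> by (simp only: Y_def)
qed

text \<open>Replaces the random range of summation by a condition on the path up to time
  \<open>n\<close>, infinite return times included.\<close>

lemma enat_less_return_time_iff:
  "enat n < return_time X k \<omega> \<longleftrightarrow> (\<forall>m\<in>{1..n}. X m \<omega> \<noteq> k)"
proof -
  have "return_time X k \<omega> \<le> enat n \<longleftrightarrow> (\<exists>m\<in>{1..n}. X m \<omega> = k)"
  proof
    assume le: "return_time X k \<omega> \<le> enat n"
    let ?S = "{enat n |n. n \<ge> 1 \<and> X n \<omega> = k}"
    \<comment> \<open>Only for a nonempty set is the infimum in \<open>enat\<close> a least element,
      and thus attained.\<close>
    have "?S \<noteq> {}"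
    proof
      assume "?S = {}"
      then have "return_time X k \<omega> = \<infinity>"
        by (simp only: return_time_def Inf_enat_def) simp
      with le show False by simp
    qed
    then have "return_time X k \<omega> \<in> ?S"
      unfolding return_time_def Inf_enat_def using LeastI[of "\<lambda>x. x \<in> ?S"] by auto
    then show "\<exists>m\<in>{1..n}. X m \<omega> = k" using le by auto
  next
    assume "\<exists>m\<in>{1..n}. X m \<omega> = k"
    then obtain m where m: "m \<in> {1..n}" "X m \<omega> = k" ..
    then have "return_time X k \<omega> \<le> enat m"
      unfolding return_time_def by (intro Inf_lower) auto
    also have "\<dots> \<le> enat n" using m by simp
    finally show "return_time X k \<omega> \<le> enat n" .
  qed
  then show ?thesis by (auto simp: not_le[symmetric])
qed

text \<open>The factor \<open>row_sum A i\<close> in the excursion weight cancels the normalisation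
  of the chain, which turns probabilities into matrix weights. In a zero row both sides are
  0.\<close>

lemma row_sum_mult_transition_prob:
  fixes A :: "'a::countable \<Rightarrow> 'a \<Rightarrow> real"
  assumes "nonneg_matrix A" "row_sum A i < \<infinity>"
  shows "row_sum A i * ennreal (transition_prob A i j) = ennreal (A i j)"
proof (cases "row_sum A i = 0")
  case True
  then have "\<forall>j. ennreal (A i j) = 0"
    by (simp add: row_sum_def infsum_ennreal_eq_nn_integral nn_integral_0_iff_AE AE_count_space)
  then show ?thesis using True by simp
next
  case False
  define f where "f = enn2real (row_sum A i)"
  have f: "row_sum A i = ennreal f" "0 < f"
    using False assms(2) by (auto simp: f_def enn2real_positive_iff zero_less_iff_neq_zero)
  have "0 \<le> A i j" using assms(1) by (simp add: nonneg_matrix_def)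
  then show ?thesis
    using f(2) unfolding transition_prob_def f_def[symmetric] f(1)
    by (simp add: ennreal_mult[symmetric])
qed

text \<open>Induction on \<open>n\<close>: the Markov property replaces the indicator of the next
  state by a transition probability, and the new factor \<open>row_sum A (X n \<omega>)\<close>
  turns this into an entry of \<open>A\<close>, which is the recursion of
  \<open>taboo_weight\<close>.\<close>

lemma expectation_excursion_weight:
  fixes A :: "'a::countable \<Rightarrow> 'a \<Rightarrow> real" and X :: "nat \<Rightarrow> 'w \<Rightarrow> 'a"
  assumes A: "nonneg_matrix A" "\<And>i. row_sum A i < \<infinity>"
    and mc: "markov_chain_from M X (transition_prob A) k"
  defines "Z \<equiv> \<lambda>n \<omega>. (if \<forall>m\<in>{1..n}. X m \<omega> \<noteq> k then 1 else 0) * (\<Prod>m<n. row_sum A (X m \<omega>))"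
  shows "(\<integral>\<^sup>+ \<omega>. Z n \<omega> * indicator {i} (X n \<omega>) \<partial>M) = taboo_weight A k n i"
proof (induction n arbitrary: i)
  interpret prob_space M using mc by (simp add: markov_chain_from_def)
  case 0
  have start: "AE \<omega> in M. X 0 \<omega> = k" using mc by (simp add: markov_chain_from_def)
  have "(\<integral>\<^sup>+ \<omega>. Z 0 \<omega> * indicator {i} (X 0 \<omega>) \<partial>M) = (\<integral>\<^sup>+ \<omega>. indicator {i} k \<partial>M)"
    by (rule nn_integral_cong_AE, use start in eventually_elim) (simp add: Z_def)
  then show ?case by (cases "i = k") (simp_all add: emeasure_space_1)
next
  case (Suc n)
  interpret prob_space M using mc by (simp add: markov_chain_from_def)
  interpret pair_sigma_finite "count_space (UNIV::'a set)" M
    by (simp add: pair_sigma_finite_def sigma_finite_measure_count_space sigma_finite_measure_axioms)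
  have [measurable]: "X n \<in> measurable M (count_space UNIV)" for n
    using mc by (simp add: markov_chain_from_def)
  have [measurable]: "Z n \<in> borel_measurable M" for n
    unfolding Z_def by measurable
  \<comment> \<open>Besides \<open>Z n\<close>, \<open>\<phi>\<close> contains the factor
    \<open>row_sum\<close> at time \<open>n\<close>; both depend only on the path up to time
    \<open>n\<close>.\<close>
  define \<phi> where "\<phi> xs = (if \<forall>m\<in>{1..n}. xs ! m \<noteq> k then 1 else 0) *
      (\<Prod>m<Suc n. row_sum A (xs ! m))" for xs
  have \<phi>: "\<phi> (map (\<lambda>m. X m \<omega>) [0..<Suc n]) = Z n \<omega> * row_sum A (X n \<omega>)" for \<omega>
  proof -
    have nth: "map (\<lambda>m. X m \<omega>) [0..<Suc n] ! m = X m \<omega>" if "m < Suc n" for m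
      using nth_map_upt[of m "Suc n" 0] that by simp
    then have "(\<forall>m\<in>{1..n}. map (\<lambda>m. X m \<omega>) [0..<Suc n] ! m \<noteq> k) \<longleftrightarrow> (\<forall>m\<in>{1..n}. X m \<omega> \<noteq> k)"
      by (intro ball_cong refl) (simp only: atLeastAtMost_iff less_Suc_eq_le)
    moreover have "(\<Prod>m<Suc n. row_sum A (map (\<lambda>m. X m \<omega>) [0..<Suc n] ! m)) =
        (\<Prod>m<Suc n. row_sum A (X m \<omega>))"
      by (intro prod.cong refl) (simp only: nth lessThan_iff)
    ultimately show ?thesis
      unfolding \<phi>_def Z_def by (simp only: prod.lessThan_Suc mult.assoc)
  qed
  have P: "0 \<le> transition_prob A i j" for i j
    using A(1) by (simp add: transition_prob_def nonneg_matrix_def)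
  have "(\<forall>m\<in>{1..Suc n}. X m \<omega> \<noteq> k) \<longleftrightarrow> X (Suc n) \<omega> \<noteq> k \<and> (\<forall>m\<in>{1..n}. X m \<omega> \<noteq> k)" for \<omega>
    by (subst atLeastAtMostSuc_conv) auto
  then have "Z (Suc n) \<omega> = (if X (Suc n) \<omega> = k then 0 else Z n \<omega> * row_sum A (X n \<omega>))" for \<omega>
    by (simp only: Z_def prod.lessThan_Suc) simp
  \<comment> \<open>On the event \<open>X (Suc n) \<omega> = i\<close>, avoiding \<open>k\<close> at
    time \<open>Suc n\<close> is the deterministic condition \<open>i \<noteq> k\<close>.\<close>
  then have "(\<integral>\<^sup>+ \<omega>. Z (Suc n) \<omega> * indicator {i} (X (Suc n) \<omega>) \<partial>M) =
      (\<integral>\<^sup>+ \<omega>. (if i = k then 0 else 1) * (\<phi> (map (\<lambda>m. X m \<omega>) [0..<Suc n]) * indicator {i} (X (Suc n) \<omega>)) \<partial>M)"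
    unfolding \<phi> by (intro nn_integral_cong) (simp split: split_indicator)
  also have "\<dots> = (if i = k then 0 else
      \<integral>\<^sup>+ \<omega>. \<phi> (map (\<lambda>m. X m \<omega>) [0..<Suc n]) * indicator {i} (X (Suc n) \<omega>) \<partial>M)"
    by simp
  also have "(\<integral>\<^sup>+ \<omega>. \<phi> (map (\<lambda>m. X m \<omega>) [0..<Suc n]) * indicator {i} (X (Suc n) \<omega>) \<partial>M) =
      (\<integral>\<^sup>+ \<omega>. Z n \<omega> * ennreal (A (X n \<omega>) i) \<partial>M)"
    unfolding markov_chain_step[OF mc P, of \<phi> n i] unfolding \<phi>
    by (simp add: mult.assoc row_sum_mult_transition_prob[OF A])
  \<comment> \<open>Splitting by the value \<open>l\<close> of \<open>X n\<close> exposes the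
    expectations covered by the induction hypothesis.\<close>
  also have "\<dots> = (\<integral>\<^sup>+ \<omega>. (\<integral>\<^sup>+ l. Z n \<omega> * indicator {l} (X n \<omega>) * ennreal (A l i) \<partial>count_space UNIV) \<partial>M)"
  proof (intro nn_integral_cong)
    fix \<omega>
    have "(\<integral>\<^sup>+ l. Z n \<omega> * indicator {l} (X n \<omega>) * ennreal (A l i) \<partial>count_space UNIV) =
        (\<Sum>l\<in>{X n \<omega>}. Z n \<omega> * indicator {l} (X n \<omega>) * ennreal (A l i))"
      by (rule nn_integral_count_space') auto
    then show "Z n \<omega> * ennreal (A (X n \<omega>) i) =
        (\<integral>\<^sup>+ l. Z n \<omega> * indicator {l} (X n \<omega>) * ennreal (A l i) \<partial>count_space UNIV)" by simp
  qed
  also have "\<dots> = (\<integral>\<^sup>+ l. (\<integral>\<^sup>+ \<omega>. Z n \<omega> * indicator {l} (X n \<omega>) * ennreal (A l i) \<partial>M) \<partial>count_space UNIV)"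
    by (intro Fubini' measurable_pair_measure_countable1) auto
  also have "\<dots> = (\<integral>\<^sup>+ l. taboo_weight A k n l * ennreal (A l i) \<partial>count_space UNIV)"
    by (simp add: nn_integral_multc Suc)
  finally show ?case by simp
qed

text \<open>Extending the sum by zeros beyond the return time makes its range deterministic, so
  expectation and sum of non-negative terms can be exchanged.\<close>

lemma excursion_vector_eq_taboo:
  fixes A :: "'a::countable \<Rightarrow> 'a \<Rightarrow> real" and X :: "nat \<Rightarrow> 'w \<Rightarrow> 'a"
  assumes A: "nonneg_matrix A" "\<And>i. row_sum A i < \<infinity>"
    and mc: "markov_chain_from M X (transition_prob A) k"
  shows "excursion_vector M X A R k i = (\<Sum>n. R ^ n * taboo_weight A k n i)"
proof -
  have [measurable]: "X n \<in> measurable M (count_space UNIV)" for n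
    using mc by (simp add: markov_chain_from_def)
  define Z where "Z n \<omega> = (if \<forall>m\<in>{1..n}. X m \<omega> \<noteq> k then 1 else 0) *
      (\<Prod>m<n. row_sum A (X m \<omega>))" for n \<omega>
  have [measurable]: "Z n \<in> borel_measurable M" for n
    unfolding Z_def by measurable
  have "excursion_vector M X A R k i =
      (\<integral>\<^sup>+ \<omega>. (\<Sum>n. R ^ n * (Z n \<omega> * indicator {i} (X n \<omega>))) \<partial>M)"
    unfolding excursion_vector_def
  proof (intro nn_integral_cong)
    fix \<omega>
    have "(\<Sum>\<^sub>\<infinity>n | enat n < return_time X k \<omega>.
          indicator {i} (X n \<omega>) * R ^ n * (\<Prod>m<n. row_sum A (X m \<omega>))) =
        (\<Sum>\<^sub>\<infinity>n. R ^ n * (Z n \<omega> * indicator {i} (X n \<omega>)))"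
      by (intro infsum_cong_neutral) (auto simp: enat_less_return_time_iff Z_def ac_simps)
    then show "(\<Sum>\<^sub>\<infinity>n | enat n < return_time X k \<omega>.
          indicator {i} (X n \<omega>) * R ^ n * (\<Prod>m<n. row_sum A (X m \<omega>))) =
        (\<Sum>n. R ^ n * (Z n \<omega> * indicator {i} (X n \<omega>)))"
      by (simp add: infsum_ennreal_eq_nn_integral nn_integral_count_space_nat)
  qed
  also have "\<dots> = (\<Sum>n. R ^ n * (\<integral>\<^sup>+ \<omega>. Z n \<omega> * indicator {i} (X n \<omega>) \<partial>M))"
    by (simp add: nn_integral_suminf nn_integral_cmult)
  finally show ?thesis
    unfolding Z_def expectation_excursion_weight[OF A mc] .
qed

theorem theorem1p1:
  fixes A :: "'a::countable \<Rightarrow> 'a \<Rightarrow> real"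
    and k :: 'a
    and R :: ennreal
    and M :: "'w measure"
    and X :: "nat \<Rightarrow> 'w \<Rightarrow> 'a"
    and u :: "'a \<Rightarrow> ennreal"
  assumes "nonneg_matrix A"
    and "irreducible_matrix A"
    and "\<forall>i. row_sum A i < \<infinity>"
    and "R_recurrent A R"
    and "R > 0"
    and "markov_chain_from M X (transition_prob A) k"
  defines "u \<equiv> excursion_vector M X A R k"
  shows "(\<forall>i. 0 < u i \<and> u i < \<infinity>) \<and>
         (\<forall>j. (\<Sum>\<^sub>\<infinity>i. u i * ennreal (A i j)) = (1 / R) * u j)"
proof -
  \<comment> \<open>\<open>R\<close> is an \<open>ennreal\<close>; irreducibility excludes the
    infinite value.\<close>
  have "R < \<infinity>"
    using convergence_parameter_finite[OF assms(2)] assms(4) by (auto simp: R_recurrent_def)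
  have u: "u i = (\<Sum>n. R ^ n * taboo_weight A k n i)" for i
    unfolding u_def using assms(3) by (intro excursion_vector_eq_taboo assms) auto
  note eig = excursion_eigenvector[OF assms(4,5) \<open>R < \<infinity>\<close>, of k, folded u]
  have "1 / R < \<infinity>"
    using assms(5) by (auto simp: ennreal_divide_eq_top_iff less_top[symmetric])
  then have "0 < u i" "u i < \<infinity>" for i
    using irreducible_left_eigenvector_pos_finite[OF assms(2) eig(2), of k i] by (simp_all add: eig(1))
  then show ?thesis
    by (simp add: infsum_ennreal_eq_nn_integral eig(2))
qed

end
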